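(* Let $m_{00},m_{11},m_{22},m_{33}$ be the diagonal elements, in the ordered basis $|00\rangle,|01\rangle,|10\rangle,|11\rangle$, of some two-qubit state $\rho_{AB}$, let $e_b=m_{11}+m_{22}$, and let $e_p=\mathrm{Tr}(\Pi_x^-\rho_{AB})$. Let $K_{BB84}^{opt}=C(\rho(\bar a,\bar b))-H(e_b)$, where $(\bar a,\bar b)$ minimizes $C(\rho(a,b))$ over $a,b\in\mathbb{R}$ subject to $a+b=\tfrac12-e_p$, $|a|\le\sqrt{m_{00}m_{33}}$, $|b|\le\sqrt{m_{11}m_{22}}$, with $$\rho(a,b)=\begin{pmatrix}m_{00}&0&0&a\\ 0&m_{11}&b&0\\ 0&b&m_{22}&0\\ a&0&0&m_{33}\end{pmatrix},$$ and let $K_{BB84}=1-H(e_p)-H(e_b)$. Then $$K_{BB84}^{opt}\ge K_{BB84}.$$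
   Context: Logarithms are base 2; $S(\rho)=-\mathrm{Tr}[\rho\log_2\rho]$; $H(e)=-e\log_2e-(1-e)\log_2(1-e)$. $|\pm\rangle=(|0\rangle\pm|1\rangle)/\sqrt2$ and $\Pi_x^-=|{+-}\rangle\langle{+-}|+|{-+}\rangle\langle{-+}|$. $C(\rho)=S(\rho^{\mathrm{diag}})-S(\rho)$ is the relative entropy of coherence in the reference basis $\{|00\rangle,|01\rangle,|10\rangle,|11\rangle\}$, with $\rho^{\mathrm{diag}}$ the diagonal part of $\rho$ in that basis. $K_{BB84}$ is the Shor-Preskill key rate of the BB84 protocol; $K_{BB84}^{opt}$ is the key rate obtained from the fine-grained parameters $m_{ii}$ and $e_p$. *)

theory Defs
  imports Complex_Main "Jordan_Normal_Form.Schur_Decomposition"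
begin

section \<open>States, entropy and coherence\<close>

definition trace :: "complex mat \<Rightarrow> complex" where
  "trace A = (\<Sum>i<dim_row A. A $$ (i, i))"

definition hermitian :: "complex mat \<Rightarrow> bool" where
  "hermitian A \<longleftrightarrow> mat_adjoint A = A"

definition unitary :: "nat \<Rightarrow> complex mat \<Rightarrow> bool" where
  "unitary n U \<longleftrightarrow> U \<in> carrier_mat n n \<and> U * mat_adjoint U = 1\<^sub>m n \<and> mat_adjoint U * U = 1\<^sub>m n"

text \<open>On complex numbers, \<open>0 \<le> z\<close> means that \<open>z\<close> is real and nonnegative;
  \<open>x \<bullet>c y\<close> conjugates its second argument.\<close>

definition density_operator :: "nat \<Rightarrow> complex mat \<Rightarrow> bool" where
  "density_operator n \<rho> \<longleftrightarrow>
     \<rho> \<in> carrier_mat n n \<and> hermitian \<rho> \<and>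
     (\<forall>v \<in> carrier_vec n. 0 \<le> (\<rho> *\<^sub>v v) \<bullet>c v) \<and> trace \<rho> = 1"

text \<open>Functional calculus: if \<open>A = U diag(d) U\<^sup>\<dagger>\<close> with \<open>U\<close> unitary and \<open>d\<close> real, then
  \<open>f(A) = U diag(f \<circ> d) U\<^sup>\<dagger>\<close>. The result does not depend on the chosen diagonalisation,
  so the description below is proper for every Hermitian \<open>A\<close>.\<close>

definition hermitian_fun :: "(real \<Rightarrow> real) \<Rightarrow> complex mat \<Rightarrow> complex mat" where
  "hermitian_fun f A = (THE B. \<exists>U d. unitary (dim_row A) U \<and>
      A = U * mat_diag (dim_row A) (\<lambda>i. complex_of_real (d i)) * mat_adjoint U \<and>
      B = U * mat_diag (dim_row A) (\<lambda>i. complex_of_real (f (d i))) * mat_adjoint U)"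

text \<open>The convention \<open>0 log 0 = 0\<close> is automatic here and in \<open>bin_entropy\<close>: \<open>log 2 0\<close> is some
  real number, and it is multiplied by \<open>0\<close>.\<close>

definition vN_entropy :: "complex mat \<Rightarrow> real" where
  "vN_entropy \<rho> = - Re (trace (\<rho> * hermitian_fun (log 2) \<rho>))"

definition bin_entropy :: "real \<Rightarrow> real" where
  "bin_entropy e = - e * log 2 e - (1 - e) * log 2 (1 - e)"

definition diag_part :: "complex mat \<Rightarrow> complex mat" where
  "diag_part \<rho> = mat_diag (dim_row \<rho>) (\<lambda>i. \<rho> $$ (i, i))"

definition rel_ent_coherence :: "complex mat \<Rightarrow> real" where
  "rel_ent_coherence \<rho> = vN_entropy (diag_part \<rho>) - vN_entropy \<rho>"


section \<open>Two-qubit states and the BB84 key rates\<close>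

text \<open>The basis \<open>|00\<rangle>, |01\<rangle>, |10\<rangle>, |11\<rangle>\<close> is indexed by \<open>0, 1, 2, 3\<close>.\<close>

definition ket_tensor :: "complex vec \<Rightarrow> complex vec \<Rightarrow> complex vec" where
  "ket_tensor u v = vec (dim_vec u * dim_vec v)
     (\<lambda>i. u $ (i div dim_vec v) * v $ (i mod dim_vec v))"

definition ket_bra :: "complex vec \<Rightarrow> complex mat" where
  "ket_bra v = mat (dim_vec v) (dim_vec v) (\<lambda>(i, j). v $ i * conjugate (v $ j))"

definition ket_plus :: "complex vec" where
  "ket_plus = complex_of_real (1 / sqrt 2) \<cdot>\<^sub>v (unit_vec 2 0 + unit_vec 2 1)"

definition ket_minus :: "complex vec" where
  "ket_minus = complex_of_real (1 / sqrt 2) \<cdot>\<^sub>v (unit_vec 2 0 - unit_vec 2 1)"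

definition Pi_x_minus :: "complex mat" where
  "Pi_x_minus = ket_bra (ket_tensor ket_plus ket_minus) + ket_bra (ket_tensor ket_minus ket_plus)"

definition rho_ab :: "real \<Rightarrow> real \<Rightarrow> real \<Rightarrow> real \<Rightarrow> real \<Rightarrow> real \<Rightarrow> complex mat" where
  "rho_ab m00 m11 m22 m33 a b = map_mat complex_of_real (mat_of_rows_list 4
     [[m00, 0,   0,   a  ],
      [0,   m11, b,   0  ],
      [0,   b,   m22, 0  ],
      [a,   0,   0,   m33]])"

definition feasible :: "real \<Rightarrow> real \<Rightarrow> real \<Rightarrow> real \<Rightarrow> real \<Rightarrow> real \<Rightarrow> real \<Rightarrow> bool" where
  "feasible m00 m11 m22 m33 e_p a b \<longleftrightarrow>
     a + b = 1/2 - e_p \<and> \<bar>a\<bar> \<le> sqrt (m00 * m33) \<and> \<bar>b\<bar> \<le> sqrt (m11 * m22)"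

text \<open>\<open>arg_min\<close> picks some minimiser; the value of the key rate is the same for all of them.\<close>

definition K_BB84_opt :: "real \<Rightarrow> real \<Rightarrow> real \<Rightarrow> real \<Rightarrow> real \<Rightarrow> real" where
  "K_BB84_opt m00 m11 m22 m33 e_p =
     (let (a_min, b_min) = arg_min (\<lambda>(a, b). rel_ent_coherence (rho_ab m00 m11 m22 m33 a b))
                                   (\<lambda>(a, b). feasible m00 m11 m22 m33 e_p a b);
          e_b = m11 + m22
      in rel_ent_coherence (rho_ab m00 m11 m22 m33 a_min b_min) - bin_entropy e_b)"

definition K_BB84 :: "real \<Rightarrow> real \<Rightarrow> real" where
  "K_BB84 e_b e_p = 1 - bin_entropy e_p - bin_entropy e_b"

end

theory Submission
  imports Defs
begin

text \<open>
  The matrix \<open>\<rho>(a, b)\<close> splits into two real symmetric blocks. A block with diagonal \<open>p, q\<close>,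
  half trace \<open>c = (p + q) / 2\<close> and off-diagonal entry \<open>a\<close> has eigenvalues \<open>c \<plusminus> r\<close> with
  \<open>r\<^sup>2 = ((p - q) / 2)\<^sup>2 + a\<^sup>2\<close>. With \<open>F\<^sub>c x = (c + x) ln (c + x) + (c - x) ln (c - x)\<close> the block
  contributes \<open>F\<^sub>c r - F\<^sub>c ((p - q) / 2)\<close> to the coherence, up to the factor \<open>1 / ln 2\<close>. Since
  \<open>x \<mapsto> F\<^sub>c (sqrt x) - F\<^sub>c 0\<close> is convex and vanishes at \<open>0\<close>, it is superadditive, and the
  contribution is at least \<open>F\<^sub>c a - F\<^sub>c 0\<close>. The log sum inequality merges the bounds for the two
  blocks into \<open>F\<^bsub>1/2\<^esub> (a + b) - F\<^bsub>1/2\<^esub> 0\<close>, which only depends on \<open>a + b = 1/2 - e_p\<close> and equals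
  \<open>(1 - H(e_p)) ln 2\<close>. The minimum is attained by compactness, and the feasible set contains
  the real parts of the off-diagonal entries of \<open>\<rho>\<^sub>A\<^sub>B\<close>.
\<close>


section \<open>Inequalities for the entropy function\<close>

definition xlnx :: "real \<Rightarrow> real" where
  "xlnx x = x * ln x"

lemma xlnx_0 [simp]: "xlnx 0 = 0"
  by (simp add: xlnx_def)

text \<open>At \<open>0\<close> the substitution \<open>x = 1 / y\<close> turns the limit into that
  of \<open>- ln y / y\<close> at infinity. This endpoint matters because eigenvalues may vanish on
  the boundary of the feasible set.\<close>

lemma continuous_on_xlnx: "continuous_on {0..} xlnx"
proof (unfold continuous_on_eq_continuous_within, intro ballI)
  fix x :: real assume "x \<in> {0..}"
  then consider "x = 0" | "x > 0" by fastforce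
  then show "continuous (at x within {0..}) xlnx"
  proof cases
    case 1
    have "((\<lambda>y::real. - (ln y / y)) \<longlongrightarrow> - 0) at_top"
      by (intro tendsto_minus ln_x_over_x_tendsto_0)
    moreover have "\<forall>\<^sub>F y in at_top. - (ln y / y) = xlnx (inverse y)"
      using eventually_gt_at_top[of 0]
      by eventually_elim (simp add: xlnx_def ln_inverse divide_inverse)
    ultimately have "((\<lambda>y. xlnx (inverse y)) \<longlongrightarrow> 0) at_top"
      by (auto elim: Lim_transform_eventually)
    then have "(xlnx \<longlongrightarrow> 0) (at_right 0)"
      by (simp add: filterlim_at_right_to_top)
    then show ?thesis
      using 1 by (simp add: continuous_within at_within_Ici_at_right)
  next
    case 2
    then have "isCont (\<lambda>y. y * ln y) x"
      by (intro continuous_intros) auto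
    then show ?thesis
      using continuous_at_imp_continuous_at_within by (force simp: xlnx_def[abs_def])
  qed
qed

lemma DERIV_xlnx: "0 < x \<Longrightarrow> (xlnx has_real_derivative ln x + 1) (at x)"
  unfolding xlnx_def[abs_def]
  by (auto intro!: derivative_eq_intros simp: field_simps)

text \<open>Follows by adding the tangent bound \<open>ln z \<le> z - 1\<close> over both terms. The
  last two hypotheses exclude terms whose relative entropy would be infinite.\<close>

lemma log_sum_inequality:
  assumes "0 \<le> x1" "0 \<le> x2" "0 \<le> y1" "0 \<le> y2" "y1 = 0 \<Longrightarrow> x1 = 0" "y2 = 0 \<Longrightarrow> x2 = 0"
  shows "xlnx (x1 + x2) - (x1 + x2) * ln (y1 + y2) \<le> (xlnx x1 - x1 * ln y1) + (xlnx x2 - x2 * ln y2)"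
proof -
  define x y where "x = x1 + x2" and "y = y1 + y2"
  \<comment> \<open>The tangent bound at \<open>z = x v / (y u)\<close>. For the two pairs the
    right-hand sides add up to \<open>x - x = 0\<close>.\<close>
  have gibbs: "u * (ln x - ln y) - (xlnx u - u * ln v) \<le> v * x / y - u"
    if "0 \<le> u" "u \<le> x" "0 \<le> v" "v \<le> y" "v = 0 \<Longrightarrow> u = 0" for u v
  proof (cases "u = 0")
    case True
    with that assms show ?thesis by (simp add: x_def y_def)
  next
    case False
    with that have pos: "0 < u" "0 < v" "0 < x" "0 < y" by force+
    have "u * ln (x * v / (y * u)) \<le> u * (x * v / (y * u) - 1)"
      using pos by (intro mult_left_mono ln_le_minus_one) auto
    also have "\<dots> = v * x / y - u"
      using pos by (simp add: field_simps)
    finally show ?thesis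
      using pos by (simp add: xlnx_def ln_div ln_mult algebra_simps)
  qed
  have "y1 * x / y + y2 * x / y = x"
    using assms by (cases "y = 0") (auto simp: x_def y_def add_nonneg_eq_0_iff simp flip: add_divide_distrib distrib_right)
  with gibbs[of x1 y1] gibbs[of x2 y2] assms show ?thesis
    unfolding x_def[symmetric] y_def[symmetric] xlnx_def[of x]
    by (simp add: x_def y_def algebra_simps)
qed

text \<open>Minus the entropy, in nats and without normalisation, of a block with eigenvalues
  \<open>c + x\<close> and \<open>c - x\<close>; this is \<open>F\<^sub>c\<close> above.\<close>

definition xlnx_sym :: "real \<Rightarrow> real \<Rightarrow> real" where
  "xlnx_sym c x = xlnx (c + x) + xlnx (c - x)"

lemma xlnx_sym_abs: "xlnx_sym c \<bar>x\<bar> = xlnx_sym c x"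
  by (simp add: xlnx_sym_def abs_if)

lemma continuous_on_xlnx_sym:
  assumes "continuous_on S f" "\<And>t. t \<in> S \<Longrightarrow> \<bar>f t\<bar> \<le> c"
  shows "continuous_on S (\<lambda>t. xlnx_sym c (f t))"
  unfolding xlnx_sym_def using assms
  by (intro continuous_intros continuous_on_compose2[OF continuous_on_xlnx])
     (auto simp: abs_le_iff, smt+)

lemma DERIV_xlnx_sym:
  assumes "\<bar>x\<bar> < c"
  shows "(xlnx_sym c has_real_derivative ln (c + x) - ln (c - x)) (at x)"
  unfolding xlnx_sym_def[abs_def] using assms
  by (auto intro!: derivative_eq_intros DERIV_chain2[OF DERIV_xlnx])

text \<open>The derivative \<open>2 c / (c\<^sup>2 - x\<^sup>2)\<close> of \<open>x \<mapsto> ln (c + x) - ln (c - x)\<close> is increasing, so this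
  function is convex on \<open>{0..<c}\<close>.\<close>

lemma ln_ratio_star_shaped:
  fixes c u r :: real
  assumes "0 < u" "u < r" "r < c"
  shows "r * (ln (c + u) - ln (c - u)) \<le> u * (ln (c + r) - ln (c - r))"
proof -
  define g where "g = (\<lambda>x. ln (c + x) - ln (c - x))"
  define g' where "g' = (\<lambda>x. 1 / (c + x) + 1 / (c - x))"
  have dg: "(g has_real_derivative g' x) (at x)" if "0 \<le> x" "x < c" for x
    unfolding g_def g'_def using that by (auto intro!: derivative_eq_intros)
  \<comment> \<open>The chord slopes of \<open>g\<close> over \<open>[0, u]\<close> and
    \<open>[u, r]\<close> are \<open>g' v\<close> and \<open>g' w\<close> with
    \<open>v < u < w\<close>. Ordering them and using \<open>g 0 = 0\<close> gives the
    claim.\<close>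
  obtain v where v: "0 < v" "v < u" "g u - g 0 = (u - 0) * g' v"
    using MVT2[of 0 u g g'] dg assms by force
  obtain w where w: "u < w" "w < r" "g r - g u = (r - u) * g' w"
    using MVT2[of u r g g'] dg assms by force
  have eq: "g' x = 2 * c / (c\<^sup>2 - x\<^sup>2)" if "0 \<le> x" "x < c" for x
    using that unfolding g'_def by (simp add: power2_eq_square field_simps)
  have "v\<^sup>2 \<le> w\<^sup>2" "w\<^sup>2 < c\<^sup>2" "v\<^sup>2 < c\<^sup>2"
    using v w assms by (auto intro!: power_mono power_strict_mono)
  then have "g' v \<le> g' w"
    using v w assms by (auto simp: eq intro!: divide_left_mono mult_pos_pos)
  then have "u * (r - u) * g' v \<le> u * (r - u) * g' w"
    using assms by (intro mult_left_mono) auto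
  moreover have g_0: "g 0 = 0"
    by (simp add: g_def)
  moreover have "r * g u = u * g u + u * (r - u) * g' v"
    using v(3) g_0 by (simp add: algebra_simps)
  moreover have "u * g r = u * g u + u * (r - u) * g' w"
    using w(3) by (simp add: diff_eq_eq) (simp add: algebra_simps)
  ultimately have "r * g u \<le> u * g r"
    by linarith
  then show ?thesis by (simp add: g_def)
qed

text \<open>By the previous lemma \<open>xlnx_sym c (sqrt (t\<^sup>2 + y\<^sup>2)) - xlnx_sym c t\<close> is nondecreasing in \<open>t \<ge> 0\<close>;
  \<open>t = 0\<close> gives the claim.\<close>

lemma xlnx_sym_superadditive:
  assumes "sqrt (x\<^sup>2 + y\<^sup>2) \<le> c"
  shows "xlnx_sym c x + xlnx_sym c y \<le> xlnx_sym c (sqrt (x\<^sup>2 + y\<^sup>2)) + xlnx_sym c 0"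
\<comment> \<open>For nonzero \<open>y\<close> the radius \<open>r t\<close> is positive and
  strictly larger than \<open>|t|\<close>: the first makes \<open>r\<close> differentiable, the
  second is what \<open>ln_ratio_star_shaped\<close> requires.\<close>
proof (cases "y = 0")
  case True
  then show ?thesis by (simp add: xlnx_sym_abs)
next
  case False
  define r where "r = (\<lambda>t. sqrt (t\<^sup>2 + y\<^sup>2))"
  define D where "D = (\<lambda>t. xlnx_sym c (r t) - xlnx_sym c t)"
  have r_pos: "0 < r t" for t
    using False by (simp add: r_def add_nonneg_pos)
  have r_gt: "\<bar>t\<bar> < r t" for t
    using False unfolding r_def by (intro real_less_rsqrt) simp
  have r_mono: "r s < r t" if "0 \<le> s" "s < t" for s t
    using that by (auto simp: r_def intro: power_strict_mono)
  have r_le: "r t \<le> c" if "0 \<le> t" "t \<le> \<bar>x\<bar>" for t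
  proof -
    have "r t \<le> r \<bar>x\<bar>"
      using that by (cases "t = \<bar>x\<bar>") (auto intro!: less_imp_le[OF r_mono])
    also have "\<dots> \<le> c"
      using assms by (simp add: r_def)
    finally show ?thesis .
  qed
  have "D 0 \<le> D \<bar>x\<bar>"
  \<comment> \<open>Derivatives are taken on the open interval only: at \<open>t = |x|\<close> the
    radius may reach \<open>c\<close>, where \<open>ln (c - r t)\<close> blows up while
    \<open>D\<close> stays continuous.\<close>
  proof (rule DERIV_nonneg_imp_increasing_open[where f = D])
    fix t assume t: "0 < t" "t < \<bar>x\<bar>"
    then have less: "t < r t" "r t < c"
      using r_gt[of t] r_mono[of t "\<bar>x\<bar>"] r_le[of "\<bar>x\<bar>"] by auto
    let ?g = "\<lambda>s. ln (c + s) - ln (c - s)"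
    have "(r has_real_derivative t / r t) (at t)"
      unfolding r_def using r_pos[of t] t
      by (auto intro!: derivative_eq_intros simp: r_def not_sum_power2_lt_zero divide_simps)
    then have "(D has_real_derivative ?g (r t) * (t / r t) - ?g t) (at t)"
      unfolding D_def using less t r_pos[of t]
      by (intro DERIV_diff DERIV_chain2[OF DERIV_xlnx_sym] DERIV_xlnx_sym) auto
    moreover have "0 \<le> ?g (r t) * (t / r t) - ?g t"
      using ln_ratio_star_shaped[of t "r t" c] t less r_pos[of t] by (simp add: field_simps)
    ultimately show "\<exists>d. (D has_real_derivative d) (at t) \<and> 0 \<le> d" by blast
  next
    have "\<bar>r t\<bar> \<le> c" "\<bar>t\<bar> \<le> c" if "t \<in> {0..\<bar>x\<bar>}" for t
      using r_le[of t] r_gt[of t] r_pos[of t] that by auto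
    moreover have "continuous_on {0..\<bar>x\<bar>} r"
      unfolding r_def by (intro continuous_intros)
    ultimately show "continuous_on {0..\<bar>x\<bar>} D"
      unfolding D_def by (intro continuous_intros continuous_on_xlnx_sym) auto
  qed auto
  then show ?thesis
    by (simp add: D_def r_def xlnx_sym_abs)
qed

text \<open>The log sum inequality is applied to the plus eigenvalues and to the minus eigenvalues,
  both against the weights \<open>c, d\<close>. On adding, \<open>a\<close> and \<open>b\<close>
  cancel from the coefficients of \<open>ln c\<close> and \<open>ln d\<close>, leaving
  \<open>xlnx_sym c 0\<close> and \<open>xlnx_sym d 0\<close>.\<close>

lemma xlnx_sym_joint_subadditive:
  assumes "\<bar>a\<bar> \<le> c" "\<bar>b\<bar> \<le> d"
  shows "xlnx_sym (c + d) (a + b) - xlnx_sym (c + d) 0 \<le> (xlnx_sym c a - xlnx_sym c 0) + (xlnx_sym d b - xlnx_sym d 0)"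
proof -
  have "0 \<le> c + a" "0 \<le> c - a" "0 \<le> d + b" "0 \<le> d - b" "0 \<le> c" "0 \<le> d"
    "c = 0 \<Longrightarrow> a = 0" "d = 0 \<Longrightarrow> b = 0"
    using assms by auto
  then show ?thesis
    using log_sum_inequality[of "c + a" "d + b" c d] log_sum_inequality[of "c - a" "d - b" c d]
    by (simp add: xlnx_sym_def xlnx_def[of c] xlnx_def[of d] xlnx_def[of "c + d"] algebra_simps)
qed


section \<open>Matrices, functional calculus and entropy\<close>

lemma less_4_cases:
  fixes i :: nat
  assumes "i < 4"
  obtains "i = 0" | "i = 1" | "i = 2" | "i = 3"
  using assms by linarith

lemma sum_less_4: "(\<Sum>i<4. f i) = f 0 + f 1 + f 2 + f (3::nat)"
  by (simp add: numeral_eq_Suc)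

lemma eq_4x4_matI:
  assumes "A \<in> carrier_mat 4 4" "B \<in> carrier_mat 4 4"
    and "A $$ (0, 0) = B $$ (0, 0)" "A $$ (0, 1) = B $$ (0, 1)" "A $$ (0, 2) = B $$ (0, 2)" "A $$ (0, 3) = B $$ (0, 3)"
    and "A $$ (1, 0) = B $$ (1, 0)" "A $$ (1, 1) = B $$ (1, 1)" "A $$ (1, 2) = B $$ (1, 2)" "A $$ (1, 3) = B $$ (1, 3)"
    and "A $$ (2, 0) = B $$ (2, 0)" "A $$ (2, 1) = B $$ (2, 1)" "A $$ (2, 2) = B $$ (2, 2)" "A $$ (2, 3) = B $$ (2, 3)"
    and "A $$ (3, 0) = B $$ (3, 0)" "A $$ (3, 1) = B $$ (3, 1)" "A $$ (3, 2) = B $$ (3, 2)" "A $$ (3, 3) = B $$ (3, 3)"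
  shows "A = B"
proof (rule eq_matI)
  fix i j assume "i < dim_row B" "j < dim_col B"
  then have "i < 4" "j < 4"
    using assms(2) by auto
  then show "A $$ (i, j) = B $$ (i, j)"
    by (elim less_4_cases) (simp_all only: assms)
qed (use assms in auto)

lemma mat_of_rows_list_carrier:
  "length rs = n \<Longrightarrow> mat_of_rows_list m rs \<in> carrier_mat n m"
  by (auto simp: mat_of_rows_list_def)

lemma mat_adjoint_eq_mat:
  fixes A :: "complex mat"
  shows "mat_adjoint A = mat (dim_col A) (dim_row A) (\<lambda>(i, j). cnj (A $$ (j, i)))"
  unfolding mat_adjoint_def
  by (rule eq_matI) (auto simp: mat_of_rows_def)

lemma mat_adjoint_carrier [simp]:
  fixes A :: "complex mat"
  shows "A \<in> carrier_mat n m \<Longrightarrow> mat_adjoint A \<in> carrier_mat m n"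
  by (auto simp: mat_adjoint_eq_mat)

lemma trace_comm:
  assumes "A \<in> carrier_mat n m" "B \<in> carrier_mat m n"
  shows "trace (A * B) = trace (B * A)"
proof -
  have "trace (A * B) = (\<Sum>i<n. \<Sum>j<m. A $$ (i, j) * B $$ (j, i))"
    using assms by (auto simp: trace_def scalar_prod_def atLeast0LessThan intro!: sum.cong)
  also have "\<dots> = (\<Sum>j<m. \<Sum>i<n. B $$ (j, i) * A $$ (i, j))"
    by (subst sum.swap) (simp add: mult.commute)
  also have "\<dots> = trace (B * A)"
    using assms by (auto simp: trace_def scalar_prod_def atLeast0LessThan intro!: sum.cong)
  finally show ?thesis .
qed

lemma trace_mat_diag: "trace (mat_diag n d) = (\<Sum>i<n. d i)"
  by (simp add: trace_def mat_diag_def)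

text \<open>The unitary \<open>V\<^sup>\<dagger> U\<close> intertwines the two diagonal matrices, so it only mixes
  indices with equal diagonal entries.\<close>

lemma functional_calculus_unique:
  fixes d e :: "nat \<Rightarrow> real" and f :: "real \<Rightarrow> real" and n :: nat
  defines "D \<equiv> \<lambda>h d. mat_diag n (\<lambda>i. complex_of_real (h (d i :: real)))"
  assumes U: "unitary n U" and V: "unitary n V"
    and eq: "U * D id d * mat_adjoint U = V * D id e * mat_adjoint V"
  shows "U * D f d * mat_adjoint U = V * D f e * mat_adjoint V"
proof -
  have carrier [simp]: "U \<in> carrier_mat n n" "V \<in> carrier_mat n n"
      "mat_adjoint U \<in> carrier_mat n n" "mat_adjoint V \<in> carrier_mat n n"
      "\<And>h d. D h d \<in> carrier_mat n n"
    and UU: "U * mat_adjoint U = 1\<^sub>m n" "mat_adjoint U * U = 1\<^sub>m n"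
    and VV: "V * mat_adjoint V = 1\<^sub>m n" "mat_adjoint V * V = 1\<^sub>m n"
    using U V by (auto simp: unitary_def D_def)
  note assoc = assoc_mult_mat[of _ n n _ n _ n]
  have cancel: "mat_adjoint U * (U * X) = X" "mat_adjoint V * (V * X) = X"
      "U * (mat_adjoint U * X) = X" "V * (mat_adjoint V * X) = X"
    if "X \<in> carrier_mat n n" for X
    using that by (simp_all add: assoc[symmetric] UU VV)
  define W where "W = mat_adjoint V * U"
  have W: "W \<in> carrier_mat n n"
    by (simp add: W_def mult_carrier_mat[of _ n n])
  have "W * D id d = mat_adjoint V * (U * D id d * mat_adjoint U) * U"
    by (simp add: W_def assoc UU mult_carrier_mat[of _ n n] right_mult_one_mat[of _ n n])
  also have "\<dots> = D id e * W"
    unfolding eq by (simp add: W_def assoc cancel mult_carrier_mat[of _ n n])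
  finally have intertwine: "W * D id d = D id e * W" .
  have "W * D f d = D f e * W"
  proof (rule eq_matI)
    fix i j assume "i < dim_row (D f e * W)" "j < dim_col (D f e * W)"
    then have ij: "i < n" "j < n"
      using W by (auto simp: D_def mat_diag_def)
    have entry: "(W * D h d) $$ (i, j) = W $$ (i, j) * h (d j)"
        "(D h e * W) $$ (i, j) = h (e i) * W $$ (i, j)" for h
      unfolding D_def mat_diag_mult_left[OF W] mat_diag_mult_right[OF W] using ij by auto
    have "W $$ (i, j) * complex_of_real (id (d j)) = complex_of_real (id (e i)) * W $$ (i, j)"
      by (simp only: entry[symmetric] intertwine)
    then have "W $$ (i, j) = 0 \<or> d j = e i"
      by auto
    then show "(W * D f d) $$ (i, j) = (D f e * W) $$ (i, j)"
      by (auto simp: entry)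
  qed (use W in \<open>auto simp: D_def mat_diag_def\<close>)
  then have "V * (W * D f d) * mat_adjoint U = V * (D f e * W) * mat_adjoint U"
    by simp
  then show ?thesis
    by (simp add: W_def assoc cancel UU mult_carrier_mat[of _ n n] right_mult_one_mat[of _ n n])
qed

text \<open>Uniqueness makes the definite description proper, so any diagonalisation at hand may be
  used to evaluate it.\<close>

lemma hermitian_fun_eq:
  assumes U: "unitary n U"
    and A: "A = U * mat_diag n (\<lambda>i. complex_of_real (d i)) * mat_adjoint U"
  shows "hermitian_fun f A = U * mat_diag n (\<lambda>i. complex_of_real (f (d i))) * mat_adjoint U"
proof -
  have n: "dim_row A = n"
    using U by (auto simp: A unitary_def)
  show ?thesis
    unfolding hermitian_fun_def n
  proof (rule the_equality)
    fix B
    assume "\<exists>V e. unitary n V \<and> A = V * mat_diag n (\<lambda>i. complex_of_real (e i)) * mat_adjoint V \<and>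
      B = V * mat_diag n (\<lambda>i. complex_of_real (f (e i))) * mat_adjoint V"
    then show "B = U * mat_diag n (\<lambda>i. complex_of_real (f (d i))) * mat_adjoint U"
      using functional_calculus_unique[OF _ U, of _ _ d f] A by auto
  qed (use U A in blast)
qed

text \<open>\<open>A\<close> and its logarithm are diagonal in the same basis \<open>U\<close>, and
  cyclicity of the trace removes \<open>U\<close> from their product.\<close>

lemma vN_entropy_diagonalization:
  assumes U: "unitary n U"
    and A: "A = U * mat_diag n (\<lambda>i. complex_of_real (d i)) * mat_adjoint U"
  shows "vN_entropy A = - (\<Sum>i<n. d i * log 2 (d i))"
proof -
  let ?D = "\<lambda>d. mat_diag n (\<lambda>i. complex_of_real (d i))"
  have carrier [simp]: "U \<in> carrier_mat n n" "mat_adjoint U \<in> carrier_mat n n"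
      "\<And>d. ?D d \<in> carrier_mat n n"
    and UU: "mat_adjoint U * U = 1\<^sub>m n"
    using U by (auto simp: unitary_def)
  note assoc = assoc_mult_mat[of _ n n _ n _ n]
  have cancel: "mat_adjoint U * (U * X) = X" if "X \<in> carrier_mat n n" for X
    using that by (simp add: assoc[symmetric] UU)
  have "A * hermitian_fun (log 2) A = (U * (?D d * ?D (\<lambda>i. log 2 (d i)))) * mat_adjoint U"
    unfolding hermitian_fun_eq[OF U A] unfolding A
    by (simp del: mat_diag_diag add: assoc cancel mult_carrier_mat[of _ n n])
  also have "trace \<dots> = trace (mat_adjoint U * (U * (?D d * ?D (\<lambda>i. log 2 (d i)))))"
    by (rule trace_comm[of _ n n]) (simp_all add: mult_carrier_mat[of _ n n])
  also have "\<dots> = (\<Sum>i<n. complex_of_real (d i * log 2 (d i)))"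
    by (simp add: cancel trace_mat_diag)
  finally show ?thesis
    by (simp add: vN_entropy_def)
qed

lemma vN_entropy_mat_diag:
  "vN_entropy (mat_diag n (\<lambda>i. complex_of_real (d i))) = - (\<Sum>i<n. d i * log 2 (d i))"
proof (rule vN_entropy_diagonalization)
  have "mat_adjoint (1\<^sub>m n) = (1\<^sub>m n :: complex mat)"
    by (auto simp: mat_adjoint_eq_mat)
  then show "unitary n (1\<^sub>m n)"
    "mat_diag n (\<lambda>i. complex_of_real (d i)) =
      1\<^sub>m n * mat_diag n (\<lambda>i. complex_of_real (d i)) * mat_adjoint (1\<^sub>m n)"
    by (simp_all add: unitary_def right_mult_one_mat[OF mat_diag_dim] left_mult_one_mat[OF mat_diag_dim])
qed

text \<open>Testing positivity on real combinations of the basis vectors \<open>i\<close> and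
  \<open>j\<close> gives a nonnegative real quadratic form, which sees only the real part of the
  off-diagonal entry.\<close>

lemma density_operator_minor:
  assumes \<rho>: "density_operator n \<rho>" and ij: "i < n" "j < n" "i \<noteq> j"
  shows "0 \<le> Re (\<rho> $$ (i, i))" "\<bar>Re (\<rho> $$ (i, j))\<bar> \<le> sqrt (Re (\<rho> $$ (i, i)) * Re (\<rho> $$ (j, j)))"
proof -
  have carrier: "\<rho> \<in> carrier_mat n n"
    and herm: "mat_adjoint \<rho> = \<rho>"
    and pos: "\<And>v. v \<in> carrier_vec n \<Longrightarrow> 0 \<le> (\<rho> *\<^sub>v v) \<bullet>c v"
    using \<rho> by (auto simp: density_operator_def hermitian_def)
  let ?p = "Re (\<rho> $$ (i, i))" and ?q = "Re (\<rho> $$ (j, j))" and ?a = "Re (\<rho> $$ (i, j))"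
  have "\<rho> $$ (j, i) = cnj (\<rho> $$ (i, j))"
    using arg_cong[OF herm, of "\<lambda>A. A $$ (j, i)"] carrier ij by (simp add: mat_adjoint_eq_mat)
  then have a: "Re (\<rho> $$ (j, i)) = ?a"
    by simp
  have form: "0 \<le> x * x * ?p + 2 * (x * y * ?a) + y * y * ?q" for x y :: real
  proof -
    define v where "v = vec n (\<lambda>k. complex_of_real ((if k = i then x else 0) + (if k = j then y else 0)))"
    have row: "(\<rho> *\<^sub>v v) $ k = \<rho> $$ (k, i) * x + \<rho> $$ (k, j) * y" if "k < n" for k
      using that carrier ij
      by (simp add: v_def scalar_prod_def distrib_left sum.distrib if_distrib[of complex_of_real] if_distrib[of "\<lambda>z. _ * z"] cong: if_cong)
    have "(\<rho> *\<^sub>v v) \<bullet>c v = (\<Sum>k<n. (\<rho> *\<^sub>v v) $ k * v $ k)"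
      using carrier by (auto simp: scalar_prod_def v_def atLeast0LessThan intro!: sum.cong)
    also have "\<dots> = (\<rho> *\<^sub>v v) $ i * x + (\<rho> *\<^sub>v v) $ j * y"
      using ij by (simp add: v_def distrib_left sum.distrib if_distrib[of complex_of_real] if_distrib[of "\<lambda>z. _ * z"] cong: if_cong)
    finally have "Re ((\<rho> *\<^sub>v v) \<bullet>c v) = x * x * ?p + 2 * (x * y * ?a) + y * y * ?q"
      using row ij a by (simp add: algebra_simps)
    moreover have "0 \<le> Re ((\<rho> *\<^sub>v v) \<bullet>c v)"
      using pos[of v] by (simp add: v_def less_eq_complex_def)
    ultimately show ?thesis
      by simp
  qed
  show p: "0 \<le> ?p"
    using form[of 1 0] by simp
  have q: "0 \<le> ?q"
    using form[of 0 1] by simp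
  have "?a\<^sup>2 \<le> ?p * ?q"
  \<comment> \<open>If both diagonal entries vanish, the arguments \<open>(1, 1)\<close> and
    \<open>(1, -1)\<close> force \<open>?a = 0\<close>. Otherwise \<open>(?q, - ?a)\<close> and
    \<open>(- ?a, ?p)\<close> give the determinant times \<open>?q\<close> and times
    \<open>?p\<close>, one of which is a positive factor.\<close>
  proof (cases "?p = 0 \<and> ?q = 0")
    case True
    then have "?a = 0"
      using form[of 1 1] form[of 1 "-1"] by simp
    then show ?thesis
      using True by simp
  next
    case False
    have "0 \<le> ?q * (?p * ?q - ?a\<^sup>2)"
      using form[of ?q "- ?a"] by (simp add: power2_eq_square algebra_simps)
    moreover have "0 \<le> ?p * (?p * ?q - ?a\<^sup>2)"
      using form[of "- ?a" ?p] by (simp add: power2_eq_square algebra_simps)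
    ultimately show ?thesis
      using False p q by (auto simp: zero_le_mult_iff)
  qed
  then show "\<bar>?a\<bar> \<le> sqrt (?p * ?q)"
    by (simp add: real_le_rsqrt)
qed


section \<open>The coherence of the two-qubit family\<close>

definition half_gap :: "real \<Rightarrow> real \<Rightarrow> real \<Rightarrow> real" where
  "half_gap p q a = sqrt (((p - q) / 2)\<^sup>2 + a\<^sup>2)"

text \<open>Write \<open>((p - q) / 2, a)\<close> in polar coordinates with radius
  \<open>half_gap p q a\<close> and angle \<open>t\<close>. Rotation by \<open>t / 2\<close>
  diagonalises the block, by the double-angle formulas.\<close>

lemma symmetric_2x2_diagonalization:
  fixes p q a :: real
  obtains c s where "c\<^sup>2 + s\<^sup>2 = 1"
    "p = c\<^sup>2 * ((p + q) / 2 + half_gap p q a) + s\<^sup>2 * ((p + q) / 2 - half_gap p q a)"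
    "q = s\<^sup>2 * ((p + q) / 2 + half_gap p q a) + c\<^sup>2 * ((p + q) / 2 - half_gap p q a)"
    "a = c * s * (2 * half_gap p q a)"
proof -
  let ?r = "half_gap p q a"
  have r2: "((p - q) / 2)\<^sup>2 + a\<^sup>2 = ?r\<^sup>2"
    by (simp add: half_gap_def)
  obtain t where t: "(p - q) / 2 = ?r * cos t" "a = ?r * sin t"
  proof (cases "?r = 0")
    case True
    then have "((p - q) / 2)\<^sup>2 + a\<^sup>2 = 0"
      using r2 by simp
    then show ?thesis
      using that[of 0] True by (simp add: sum_power2_eq_zero_iff)
  next
    case False
    have "((p - q) / 2 / ?r)\<^sup>2 + (a / ?r)\<^sup>2 = (((p - q) / 2)\<^sup>2 + a\<^sup>2) / ?r\<^sup>2"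
      by (simp add: power_divide add_divide_distrib)
    also have "\<dots> = 1"
      using False unfolding r2 by simp
    finally obtain t where "(p - q) / 2 / ?r = cos t" "a / ?r = sin t"
      by (rule sincos_total_2pi)
    then show ?thesis
      using that[of t] False by (simp add: field_simps)
  qed
  have double: "(cos (t / 2))\<^sup>2 - (sin (t / 2))\<^sup>2 = cos t"
      "(sin (t / 2))\<^sup>2 - (cos (t / 2))\<^sup>2 = - cos t" "sin t = 2 * (sin (t / 2) * cos (t / 2))"
    using cos_double[of "t / 2"] sin_double[of "t / 2"] by simp_all
  have one: "(cos (t / 2))\<^sup>2 + (sin (t / 2))\<^sup>2 = 1" "(sin (t / 2))\<^sup>2 + (cos (t / 2))\<^sup>2 = 1"
    by simp_all
  have comb: "C * (h + r) + S * (h - r) = (C + S) * h + (C - S) * r" for C S h r :: real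
    by (simp add: algebra_simps)
  have "p = (cos (t / 2))\<^sup>2 * ((p + q) / 2 + ?r) + (sin (t / 2))\<^sup>2 * ((p + q) / 2 - ?r)"
    "q = (sin (t / 2))\<^sup>2 * ((p + q) / 2 + ?r) + (cos (t / 2))\<^sup>2 * ((p + q) / 2 - ?r)"
    unfolding comb double(1,2) one using t(1) by (simp_all add: field_simps)
  moreover have "a = cos (t / 2) * sin (t / 2) * (2 * ?r)"
    using t(2) unfolding double(3) by (simp add: algebra_simps)
  ultimately show thesis
    using that[OF one(1)] by blast
qed

text \<open>\<open>U\<close> rotates the planes spanned by indices \<open>0, 3\<close> and by
  \<open>1, 2\<close> independently. Its columns therefore carry the eigenvalues in the order
  \<open>x, x', y', y\<close>.\<close>

lemma rho_ab_diagonalization: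
  fixes c s c' s' x y x' y' :: real
  defines "U \<equiv> map_mat complex_of_real (mat_of_rows_list 4
     [[c, 0,  0,   - s],
      [0, c', - s', 0 ],
      [0, s', c',   0 ],
      [s, 0,  0,    c ]])"
  assumes "c\<^sup>2 + s\<^sup>2 = 1" "c'\<^sup>2 + s'\<^sup>2 = 1"
  shows "unitary 4 U"
    and "rho_ab (c\<^sup>2 * x + s\<^sup>2 * y) (c'\<^sup>2 * x' + s'\<^sup>2 * y') (s'\<^sup>2 * x' + c'\<^sup>2 * y') (s\<^sup>2 * x + c\<^sup>2 * y)
           (c * s * (x - y)) (c' * s' * (x' - y')) =
         U * mat_diag 4 (\<lambda>i. complex_of_real ([x, x', y', y] ! i)) * mat_adjoint U"
proof -
  define V where "V = map_mat complex_of_real (mat_of_rows_list 4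
     [[c,   0,    0,  s],
      [0,   c',   s', 0],
      [0,   - s', c', 0],
      [- s, 0,    0,  c]])"
  have U: "U \<in> carrier_mat 4 4" and V: "V \<in> carrier_mat 4 4"
    unfolding U_def V_def by (simp_all add: mat_of_rows_list_carrier)
  have adj: "mat_adjoint U = V"
  proof (rule eq_4x4_matI)
    show "V \<in> carrier_mat 4 4" "mat_adjoint U \<in> carrier_mat 4 4"
      using U V by simp_all
  qed (use U in \<open>simp_all add: mat_adjoint_eq_mat mat_of_rows_list_def U_def V_def\<close>)
  have cs: "complex_of_real c * of_real c + of_real s * of_real s = 1"
      "complex_of_real s * of_real s + of_real c * of_real c = 1"
      "complex_of_real c' * of_real c' + of_real s' * of_real s' = 1"
      "complex_of_real s' * of_real s' + of_real c' * of_real c' = 1"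
    using assms(2,3) by (simp_all add: power2_eq_square add.commute flip: of_real_mult of_real_add)
  have prod: "(A * B) $$ (i, j) = A $$ (i, 0) * B $$ (0, j) + A $$ (i, 1) * B $$ (1, j)
      + A $$ (i, 2) * B $$ (2, j) + A $$ (i, 3) * B $$ (3, j)"
    if "A \<in> carrier_mat 4 4" "B \<in> carrier_mat 4 4" "i < 4" "j < 4" for A B :: "complex mat" and i j
    using that by (simp add: scalar_prod_def atLeast0LessThan sum_less_4)
  have "U * V = 1\<^sub>m 4"
  proof (rule eq_4x4_matI)
    show "U * V \<in> carrier_mat 4 4"
      using U V by simp
  qed (simp_all add: prod[OF U V], simp_all add: U_def V_def mat_of_rows_list_def cs)
  moreover have "V * U = 1\<^sub>m 4"
  proof (rule eq_4x4_matI)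
    show "V * U \<in> carrier_mat 4 4"
      using U V by simp
  qed (simp_all add: prod[OF V U], simp_all add: U_def V_def mat_of_rows_list_def cs)
  ultimately show "unitary 4 U"
    using U by (simp add: unitary_def adj)
  have R: "rho_ab p q r t a b \<in> carrier_mat 4 4" for p q r t a b
    unfolding rho_ab_def by (simp add: mat_of_rows_list_carrier)
  let ?d = "\<lambda>i. complex_of_real ([x, x', y', y] ! i)"
  have UD: "U * mat_diag 4 ?d \<in> carrier_mat 4 4"
    using U by simp
  have entry: "(U * mat_diag 4 ?d) $$ (i, j) = U $$ (i, j) * ?d j" if "i < 4" "j < 4" for i j
    using that by (simp add: mat_diag_mult_right[OF U])
  show "rho_ab (c\<^sup>2 * x + s\<^sup>2 * y) (c'\<^sup>2 * x' + s'\<^sup>2 * y') (s'\<^sup>2 * x' + c'\<^sup>2 * y') (s\<^sup>2 * x + c\<^sup>2 * y)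
           (c * s * (x - y)) (c' * s' * (x' - y')) =
         U * mat_diag 4 ?d * mat_adjoint U"
    unfolding adj
  proof (rule eq_4x4_matI[OF R])
    show "U * mat_diag 4 ?d * V \<in> carrier_mat 4 4"
      using UD V by simp
  qed (simp_all add: prod[OF UD V] entry, simp_all add: rho_ab_def U_def V_def mat_of_rows_list_def algebra_simps power2_eq_square)
qed

section \<open>Entropy and coherence of the family in closed form\<close>

lemma times_log2_eq_xlnx: "x * log 2 x = xlnx x / ln 2"
  by (simp add: xlnx_def log_def)

lemma vN_entropy_rho_ab:
  "vN_entropy (rho_ab m00 m11 m22 m33 a b) =
     - (xlnx_sym ((m00 + m33) / 2) (half_gap m00 m33 a) + xlnx_sym ((m11 + m22) / 2) (half_gap m11 m22 b)) / ln 2"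
proof -
  obtain c s where cs: "c\<^sup>2 + s\<^sup>2 = 1"
    "m00 = c\<^sup>2 * ((m00 + m33) / 2 + half_gap m00 m33 a) + s\<^sup>2 * ((m00 + m33) / 2 - half_gap m00 m33 a)"
    "m33 = s\<^sup>2 * ((m00 + m33) / 2 + half_gap m00 m33 a) + c\<^sup>2 * ((m00 + m33) / 2 - half_gap m00 m33 a)"
    "a = c * s * (2 * half_gap m00 m33 a)"
    by (rule symmetric_2x2_diagonalization)
  obtain c' s' where cs': "c'\<^sup>2 + s'\<^sup>2 = 1"
    "m11 = c'\<^sup>2 * ((m11 + m22) / 2 + half_gap m11 m22 b) + s'\<^sup>2 * ((m11 + m22) / 2 - half_gap m11 m22 b)"
    "m22 = s'\<^sup>2 * ((m11 + m22) / 2 + half_gap m11 m22 b) + c'\<^sup>2 * ((m11 + m22) / 2 - half_gap m11 m22 b)"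
    "b = c' * s' * (2 * half_gap m11 m22 b)"
    by (rule symmetric_2x2_diagonalization)
  define x y where "x = (m00 + m33) / 2 + half_gap m00 m33 a" and "y = (m00 + m33) / 2 - half_gap m00 m33 a"
  define x' y' where "x' = (m11 + m22) / 2 + half_gap m11 m22 b" and "y' = (m11 + m22) / 2 - half_gap m11 m22 b"
  have "a = c * s * (x - y)" "b = c' * s' * (x' - y')"
    using cs(4) cs'(4) by (simp_all add: x_def y_def x'_def y'_def)
  then have "rho_ab m00 m11 m22 m33 a b =
      rho_ab (c\<^sup>2 * x + s\<^sup>2 * y) (c'\<^sup>2 * x' + s'\<^sup>2 * y') (s'\<^sup>2 * x' + c'\<^sup>2 * y') (s\<^sup>2 * x + c\<^sup>2 * y)
           (c * s * (x - y)) (c' * s' * (x' - y'))"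
    using cs(2,3)[folded x_def y_def] cs'(2,3)[folded x'_def y'_def] by simp
  then have "vN_entropy (rho_ab m00 m11 m22 m33 a b) = - (\<Sum>i<4. [x, x', y', y] ! i * log 2 ([x, x', y', y] ! i))"
    by (simp only: vN_entropy_diagonalization[OF rho_ab_diagonalization[OF cs(1) cs'(1)]])
  also have "\<dots> = - ((xlnx x + xlnx y) + (xlnx x' + xlnx y')) / ln 2"
    by (simp add: sum_less_4 times_log2_eq_xlnx diff_divide_distrib add_divide_distrib)
  finally show ?thesis
    by (simp add: xlnx_sym_def x_def y_def x'_def y'_def)
qed

lemma rel_ent_coherence_rho_ab:
  "rel_ent_coherence (rho_ab m00 m11 m22 m33 a b) =
     ((xlnx_sym ((m00 + m33) / 2) (half_gap m00 m33 a) - xlnx_sym ((m00 + m33) / 2) ((m00 - m33) / 2)) +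
      (xlnx_sym ((m11 + m22) / 2) (half_gap m11 m22 b) - xlnx_sym ((m11 + m22) / 2) ((m11 - m22) / 2))) / ln 2"
proof -
  have "diag_part (rho_ab m00 m11 m22 m33 a b) = mat_diag 4 (\<lambda>i. complex_of_real ([m00, m11, m22, m33] ! i))"
    by (rule eq_matI)
      (auto simp: diag_part_def mat_diag_def rho_ab_def mat_of_rows_list_def numeral_eq_Suc less_Suc_eq)
  then have "vN_entropy (diag_part (rho_ab m00 m11 m22 m33 a b)) =
      - (xlnx m00 + xlnx m11 + xlnx m22 + xlnx m33) / ln 2"
    by (simp add: vN_entropy_mat_diag sum_less_4 times_log2_eq_xlnx field_simps)
  \<comment> \<open>The diagonal entries are the half trace plus and minus
    \<open>(p - q) / 2\<close>, so the diagonal part has the same form as a block with off-diagonal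
    entry \<open>0\<close>.\<close>
  moreover have xlnx_sym: "xlnx_sym ((p + q) / 2) ((p - q) / 2) = xlnx p + xlnx q" for p q
    unfolding xlnx_sym_def by (intro arg_cong2[where f = "(+)"] arg_cong[where f = xlnx]) (simp_all add: field_simps)
  ultimately show ?thesis
    unfolding rel_ent_coherence_def vN_entropy_rho_ab xlnx_sym by (simp add: field_simps)
qed

text \<open>The upper bound is nonnegativity of the smaller eigenvalue: the constraint on
  \<open>a\<close> says that the determinant is nonnegative. Together the bounds keep all arguments
  of \<open>xlnx_sym\<close> in the range where the inequalities apply.\<close>

lemma half_gap_bounds:
  assumes "0 \<le> p" "0 \<le> q" "\<bar>a\<bar> \<le> sqrt (p * q)"
  shows "\<bar>a\<bar> \<le> half_gap p q a" "half_gap p q a \<le> (p + q) / 2"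
proof -
  have "a\<^sup>2 \<le> p * q"
    using assms(3) power_mono[of "\<bar>a\<bar>" "sqrt (p * q)" 2] assms(1,2) by simp
  moreover have "((p - q) / 2)\<^sup>2 + p * q = ((p + q) / 2)\<^sup>2"
    by (simp add: power2_eq_square field_simps)
  ultimately show "half_gap p q a \<le> (p + q) / 2"
    using assms unfolding half_gap_def by (intro real_le_lsqrt) auto
  show "\<bar>a\<bar> \<le> half_gap p q a"
    unfolding half_gap_def by (intro real_le_rsqrt) simp
qed

section \<open>Lower bound on the coherence and existence of a minimiser\<close>

lemma bin_entropy_eq_xlnx_sym: "bin_entropy e = - xlnx_sym (1 / 2) (1 / 2 - e) / ln 2"
  by (simp add: bin_entropy_def xlnx_sym_def xlnx_def log_def add_divide_distrib diff_divide_distrib)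

lemma rel_ent_coherence_ge:
  assumes m: "0 \<le> m00" "0 \<le> m11" "0 \<le> m22" "0 \<le> m33" "m00 + m11 + m22 + m33 = 1"
    and ab: "feasible m00 m11 m22 m33 e_p a b"
  shows "1 - bin_entropy e_p \<le> rel_ent_coherence (rho_ab m00 m11 m22 m33 a b)"
proof -
  let ?c = "(m00 + m33) / 2" and ?d = "(m11 + m22) / 2"
  have cd: "?c + ?d = 1 / 2"
    unfolding add_divide_distrib[symmetric] m(5)[symmetric] by simp
  have sum: "a + b = 1 / 2 - e_p"
    and ab_le: "\<bar>a\<bar> \<le> sqrt (m00 * m33)" "\<bar>b\<bar> \<le> sqrt (m11 * m22)"
    using ab by (auto simp: feasible_def)
  note half_gap = half_gap_bounds[OF m(1,4) ab_le(1)] half_gap_bounds[OF m(2,3) ab_le(2)]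
  \<comment> \<open>The two half traces add up to \<open>1/2\<close>, so merging the blocks leaves a
    quantity that depends on \<open>e_p\<close> alone.\<close>
  have "xlnx_sym (1 / 2) (1 / 2 - e_p) - xlnx_sym (1 / 2) 0 \<le> (xlnx_sym ?c a - xlnx_sym ?c 0) + (xlnx_sym ?d b - xlnx_sym ?d 0)"
    using xlnx_sym_joint_subadditive[of a ?c b ?d] half_gap unfolding sum cd by linarith
  \<comment> \<open>Superadditivity in each block, with the half difference of the diagonal entries
    and the off-diagonal entry as the two legs.\<close>
  also have "\<dots> \<le> (xlnx_sym ?c (half_gap m00 m33 a) - xlnx_sym ?c ((m00 - m33) / 2)) +
      (xlnx_sym ?d (half_gap m11 m22 b) - xlnx_sym ?d ((m11 - m22) / 2))"
    using xlnx_sym_superadditive[of "(m00 - m33) / 2" a ?c] xlnx_sym_superadditive[of "(m11 - m22) / 2" b ?d] half_gap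
    unfolding half_gap_def by linarith
  finally have "(xlnx_sym (1 / 2) (1 / 2 - e_p) - xlnx_sym (1 / 2) 0) / ln 2 \<le> rel_ent_coherence (rho_ab m00 m11 m22 m33 a b)"
    unfolding rel_ent_coherence_rho_ab by (intro divide_right_mono) auto
  \<comment> \<open>After division by \<open>ln 2\<close> this value supplies the \<open>1\<close>
    in the key rate.\<close>
  moreover have "xlnx_sym (1 / 2) 0 = - ln 2"
    by (simp add: xlnx_sym_def xlnx_def ln_div)
  ultimately show ?thesis
    by (simp add: bin_entropy_eq_xlnx_sym diff_divide_distrib add_divide_distrib)
qed

text \<open>\<open>arg_min\<close> is informative only if a minimiser exists. Eliminating
  \<open>b = k - a\<close> turns the feasible set into a compact interval, nonempty by
  \<open>ex\<close>, on which the coherence is continuous.\<close>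

lemma rel_ent_coherence_attains_min:
  assumes m: "0 \<le> m00" "0 \<le> m11" "0 \<le> m22" "0 \<le> m33"
    and ex: "feasible m00 m11 m22 m33 e_p a0 b0"
  obtains a b where "feasible m00 m11 m22 m33 e_p a b"
    "\<And>a' b'. feasible m00 m11 m22 m33 e_p a' b' \<Longrightarrow>
       rel_ent_coherence (rho_ab m00 m11 m22 m33 a b) \<le> rel_ent_coherence (rho_ab m00 m11 m22 m33 a' b')"
proof -
  define k where "k = 1 / 2 - e_p"
  define C where "C = (\<lambda>a. rel_ent_coherence (rho_ab m00 m11 m22 m33 a (k - a)))"
  let ?s = "sqrt (m00 * m33)" and ?t = "sqrt (m11 * m22)"
  let ?S = "{max (- ?s) (k - ?t)..min ?s (k + ?t)}"
  have feasible_iff: "feasible m00 m11 m22 m33 e_p a b \<longleftrightarrow> a \<in> ?S \<and> b = k - a" for a b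
    by (auto simp: feasible_def k_def abs_le_iff)
  have bounds: "\<bar>a\<bar> \<le> ?s" "\<bar>k - a\<bar> \<le> ?t" if "a \<in> ?S" for a
    using that by auto
  have half_gap: "continuous_on ?S (\<lambda>a. half_gap m00 m33 a)" "continuous_on ?S (\<lambda>a. half_gap m11 m22 (k - a))"
    unfolding half_gap_def by (intro continuous_intros; simp)+
  have "continuous_on ?S C"
    unfolding C_def rel_ent_coherence_rho_ab
  proof (intro continuous_intros continuous_on_xlnx_sym half_gap)
    fix a assume "a \<in> ?S"
    from bounds[OF this] show "\<bar>half_gap m00 m33 a\<bar> \<le> (m00 + m33) / 2" "\<bar>half_gap m11 m22 (k - a)\<bar> \<le> (m11 + m22) / 2"
      using half_gap_bounds[of m00 m33 a] half_gap_bounds[of m11 m22 "k - a"] m by auto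
  qed auto
  then obtain a where "a \<in> ?S" "\<And>a'. a' \<in> ?S \<Longrightarrow> C a \<le> C a'"
    using continuous_attains_inf[of ?S C] ex feasible_iff by blast
  then show thesis
    using that[of a "k - a"] by (auto simp: feasible_iff C_def)
qed

text \<open>This is \<open>(1 - X \<otimes> X) / 2\<close> for the bit flip \<open>X\<close>, so the
  phase error sees only the trace and the antidiagonal of a state.\<close>

lemma Pi_x_minus_eq:
  "Pi_x_minus = mat_of_rows_list 4
     [[1/2,   0,     0,     - 1/2],
      [0,     1/2,   - 1/2, 0    ],
      [0,     - 1/2, 1/2,   0    ],
      [- 1/2, 0,     0,     1/2  ]]"
proof -
  have half: "complex_of_real (1 / sqrt 2) * complex_of_real (1 / sqrt 2) = 1 / 2"
    by (simp flip: of_real_mult)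
  have kets: "ket_tensor ket_plus ket_minus = vec 4 (\<lambda>i. [1 / 2, - 1 / 2, 1 / 2, - 1 / 2] ! i)"
    "ket_tensor ket_minus ket_plus = vec 4 (\<lambda>i. [1 / 2, 1 / 2, - 1 / 2, - 1 / 2] ! i)"
    using half
    by (auto intro!: eq_vecI simp: ket_tensor_def ket_plus_def ket_minus_def elim!: less_4_cases)
  show ?thesis
    unfolding Pi_x_minus_def kets
  proof (rule eq_4x4_matI)
    show "ket_bra (vec 4 (\<lambda>i. [1 / 2, - 1 / 2, 1 / 2, - 1 / 2] ! i)) +
        ket_bra (vec 4 (\<lambda>i. [1 / 2, 1 / 2, - 1 / 2, - 1 / 2] ! i)) \<in> carrier_mat 4 4"
      by (auto simp: ket_bra_def)
  qed (rule mat_of_rows_list_carrier, simp, simp_all add: ket_bra_def mat_of_rows_list_def)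
qed

text \<open>Shows that the feasible set is nonempty. Hermiticity turns the antidiagonal sum into
  twice the real parts, which yields the linear constraint; the principal minors yield the two
  bounds.\<close>

lemma density_operator_feasible:
  assumes \<rho>: "density_operator 4 \<rho>"
  shows "feasible (Re (\<rho> $$ (0, 0))) (Re (\<rho> $$ (1, 1))) (Re (\<rho> $$ (2, 2))) (Re (\<rho> $$ (3, 3)))
           (Re (trace (Pi_x_minus * \<rho>))) (Re (\<rho> $$ (0, 3))) (Re (\<rho> $$ (1, 2)))"
proof -
  have carrier: "\<rho> \<in> carrier_mat 4 4" and herm: "mat_adjoint \<rho> = \<rho>" and tr: "trace \<rho> = 1"
    using \<rho> by (auto simp: density_operator_def hermitian_def)
  have adj: "\<rho> $$ (j, i) = cnj (\<rho> $$ (i, j))" if "i < 4" "j < 4" for i j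
    using arg_cong[OF herm, of "\<lambda>A. A $$ (j, i)"] carrier that by (simp add: mat_adjoint_eq_mat)
  have swap: "\<rho> $$ (3, 0) = cnj (\<rho> $$ (0, 3))" "\<rho> $$ (2, 1) = cnj (\<rho> $$ (1, 2))"
    by (rule adj; simp)+
  have "trace (Pi_x_minus * \<rho>) =
      (\<rho> $$ (0, 0) + \<rho> $$ (1, 1) + \<rho> $$ (2, 2) + \<rho> $$ (3, 3)) / 2
      - (\<rho> $$ (0, 3) + \<rho> $$ (3, 0) + \<rho> $$ (1, 2) + \<rho> $$ (2, 1)) / 2"
    using carrier
    by (simp add: Pi_x_minus_eq trace_def scalar_prod_def mat_of_rows_list_def atLeast0LessThan sum_less_4)
      (simp add: numeral_2_eq_2 numeral_3_eq_3 field_simps)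
  moreover have "\<rho> $$ (0, 0) + \<rho> $$ (1, 1) + \<rho> $$ (2, 2) + \<rho> $$ (3, 3) = 1"
    using tr carrier by (simp add: trace_def sum_less_4)
  ultimately have "trace (Pi_x_minus * \<rho>) =
      1 / 2 - (\<rho> $$ (0, 3) + cnj (\<rho> $$ (0, 3)) + \<rho> $$ (1, 2) + cnj (\<rho> $$ (1, 2))) / 2"
    by (simp only: swap)
  then have "Re (trace (Pi_x_minus * \<rho>)) = 1 / 2 - Re (\<rho> $$ (0, 3)) - Re (\<rho> $$ (1, 2))"
    by (simp add: add_divide_distrib)
  then show ?thesis
    using density_operator_minor(2)[OF \<rho>, of 0 3] density_operator_minor(2)[OF \<rho>, of 1 2]
    by (simp add: feasible_def)
qed

theorem corollary3:
  fixes \<rho>AB :: "complex mat" and m00 m11 m22 m33 e_b e_p :: real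
  assumes "density_operator 4 \<rho>AB"
    and "m00 = Re (\<rho>AB $$ (0, 0))"
    and "m11 = Re (\<rho>AB $$ (1, 1))"
    and "m22 = Re (\<rho>AB $$ (2, 2))"
    and "m33 = Re (\<rho>AB $$ (3, 3))"
    and "e_b = m11 + m22"
    and "e_p = Re (trace (Pi_x_minus * \<rho>AB))"
  shows "K_BB84_opt m00 m11 m22 m33 e_p \<ge> K_BB84 e_b e_p"
proof -
  have nonneg: "0 \<le> m00" "0 \<le> m11" "0 \<le> m22" "0 \<le> m33"
    \<comment> \<open>The minor lemma asks for two distinct indices: nonzero ones are paired with
      \<open>0\<close>, and \<open>0\<close> with \<open>1\<close>.\<close>
    using density_operator_minor(1)[OF assms(1), of _ 0] density_operator_minor(1)[OF assms(1), of 0 1]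
    by (auto simp: assms(2-5))
  have "trace \<rho>AB = 1" "dim_row \<rho>AB = 4"
    using assms(1) by (auto simp: density_operator_def)
  then have "Re (\<Sum>i<4. \<rho>AB $$ (i, i)) = 1"
    by (simp add: trace_def)
  then have sum: "m00 + m11 + m22 + m33 = 1"
    by (simp add: assms(2-5) numeral_eq_Suc)
  obtain a b where ab: "feasible m00 m11 m22 m33 e_p a b"
    "\<And>a' b'. feasible m00 m11 m22 m33 e_p a' b' \<Longrightarrow>
       rel_ent_coherence (rho_ab m00 m11 m22 m33 a b) \<le> rel_ent_coherence (rho_ab m00 m11 m22 m33 a' b')"
    using rel_ent_coherence_attains_min[OF nonneg] density_operator_feasible[OF assms(1)]
    unfolding assms(2-5,7) by metis
  let ?f = "\<lambda>(a, b). rel_ent_coherence (rho_ab m00 m11 m22 m33 a b)"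
  \<comment> \<open>\<open>arg_min\<close> may select a minimiser other than \<open>(a, b)\<close>,
    but the minimal value is the same.\<close>
  have "?f (arg_min ?f (\<lambda>(a, b). feasible m00 m11 m22 m33 e_p a b)) = ?f (a, b)"
    using ab by (intro arg_min_equality) auto
  then have "K_BB84_opt m00 m11 m22 m33 e_p = rel_ent_coherence (rho_ab m00 m11 m22 m33 a b) - bin_entropy e_b"
    by (simp add: K_BB84_opt_def assms(6) split: prod.splits)
  then show ?thesis
    using rel_ent_coherence_ge[OF nonneg sum ab(1)] by (simp add: K_BB84_def)
qed

end
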